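(* Let $\mathcal{S}$ be a relational structure admitting a finite monomorphic decomposition, let $\{B_1, B_2, \ldots, B_q\}$ be the minimal monomorphic decomposition of $\mathcal{S}$, and let $\mathcal{B}_i = \mathcal{S}[B_i]$ for $1 \le i \le q$. If $\mathcal{S}$ has finite big Ramsey degrees then so does every $\mathcal{B}_i$, $1 \le i \le q$.
   Context: For a relational structure $\mathcal{S} = (S, L^S)$ and a nonempty $X \subseteq S$, $\mathcal{S}[X]$ is the substructure of $\mathcal{S}$ induced by $X$. Embeddings are injective maps that preserve and reflect all relations; $\mathrm{Emb}(\mathcal{A},\mathcal{B})$ is the set of all embeddings of $\mathcal{A}$ into $\mathcal{B}$. Big Ramsey degrees: $T(\mathcal{A},\mathcal{C})$ is the least positive integer $t$ such that for every positive integer $k$ and every coloring $\chi : \mathrm{Emb}(\mathcal{A},\mathcal{C}) \to \{0,\ldots,k-1\}$ there is a $w \in \mathrm{Emb}(\mathcal{C},\mathcal{C})$ with $|\chi(w \circ \mathrm{Emb}(\mathcal{A},\mathcal{C}))| \le t$; if no such $t$ exists, $T(\mathcal{A},\mathcal{C}) = \infty$. A structure $\mathcal{C}$ has finite big Ramsey degrees if $T(\mathcal{A},\mathcal{C}) < \infty$ for every finite substructure $\mathcal{A}$ of $\mathcal{C}$ (for finite $\mathcal{C}$ this holds trivially). A monomorphic decomposition of $\mathcal{S} = (S, L^S)$ is a partition $\{E_i : i \in I\}$ of $S$ such that for all finite $X, Y \subseteq S$, if $|X \cap E_i| = |Y \cap E_i|$ for all $i \in I$ then $\mathcal{S}[X]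 \cong \mathcal{S}[Y]$. $\mathcal{S}$ admits a finite monomorphic decomposition if it has a monomorphic decomposition with $I$ finite. Every relational structure has a (unique) monomorphic decomposition such that every other monomorphic decomposition of it is a refinement of this one (Pouzet–Thiéry); it is called the minimal monomorphic decomposition. *)

theory Defs
  imports "HOL-Library.FuncSet" "HOL-Library.Disjoint_Sets" "HOL-Library.Extended_Nat"
begin

text \<open>The set of relation symbols is a set rather than the whole type, so that empty
  languages are covered; it may be infinite.\<close>

record 'r language =
  symbols :: "'r set"
  arity :: "'r \<Rightarrow> nat"

record ('a, 'r) rel_struct =
  carrier :: "'a set"
  interp :: "'r \<Rightarrow> 'a list set"

definition relational_language :: "'r language \<Rightarrow> bool" where
  "relational_language L \<longleftrightarrow> (\<forall>R\<in>symbols L. arity L R > 0)"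

definition relational_structure :: "'r language \<Rightarrow> ('a, 'r) rel_struct \<Rightarrow> bool" where
  "relational_structure L S \<longleftrightarrow>
     carrier S \<noteq> {} \<and>
     (\<forall>R\<in>symbols L. interp S R \<subseteq> {xs. length xs = arity L R \<and> set xs \<subseteq> carrier S})"

definition induced :: "('a, 'r) rel_struct \<Rightarrow> 'a set \<Rightarrow> ('a, 'r) rel_struct" where
  "induced S X = \<lparr>carrier = X, interp = (\<lambda>R. {xs \<in> interp S R. set xs \<subseteq> X})\<rparr>"

text \<open>Embeddings are extensional functions, so that two of them are equal as soon as they
  agree on the carrier of the source; composition is accordingly \<^const>\<open>compose\<close>.\<close>

definition Emb :: "'r language \<Rightarrow> ('a, 'r) rel_struct \<Rightarrow> ('b, 'r) rel_struct \<Rightarrow> ('a \<Rightarrow> 'b) set" where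
  "Emb L A B = {f \<in> carrier A \<rightarrow>\<^sub>E carrier B. inj_on f (carrier A) \<and>
     (\<forall>R\<in>symbols L. \<forall>xs. length xs = arity L R \<and> set xs \<subseteq> carrier A \<longrightarrow>
        (xs \<in> interp A R \<longleftrightarrow> map f xs \<in> interp B R))}"

definition isomorphic :: "'r language \<Rightarrow> ('a, 'r) rel_struct \<Rightarrow> ('b, 'r) rel_struct \<Rightarrow> bool" where
  "isomorphic L A B \<longleftrightarrow> (\<exists>f\<in>Emb L A B. f ` carrier A = carrier B)"

definition ramsey_bound :: "'r language \<Rightarrow> ('a, 'r) rel_struct \<Rightarrow> ('b, 'r) rel_struct \<Rightarrow> nat \<Rightarrow> bool" where
  "ramsey_bound L A C t \<longleftrightarrow> t > 0 \<and>
     (\<forall>k::nat. k > 0 \<longrightarrow> (\<forall>\<chi> \<in> Emb L A C \<rightarrow> {..<k}.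
        \<exists>w\<in>Emb L C C. card (\<chi> ` (compose (carrier A) w ` Emb L A C)) \<le> t))"

definition big_ramsey_degree :: "'r language \<Rightarrow> ('a, 'r) rel_struct \<Rightarrow> ('b, 'r) rel_struct \<Rightarrow> enat" where
  "big_ramsey_degree L A C =
     (if \<exists>t. ramsey_bound L A C t then enat (LEAST t. ramsey_bound L A C t) else \<infinity>)"

definition finite_big_ramsey_degrees :: "'r language \<Rightarrow> ('a, 'r) rel_struct \<Rightarrow> bool" where
  "finite_big_ramsey_degrees L C \<longleftrightarrow>
     (\<forall>X. X \<subseteq> carrier C \<and> finite X \<and> X \<noteq> {} \<longrightarrow> big_ramsey_degree L (induced C X) C < \<infinity>)"

definition monomorphic_decomposition :: "'r language \<Rightarrow> ('a, 'r) rel_struct \<Rightarrow> 'a set set \<Rightarrow> bool" where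
  "monomorphic_decomposition L S \<E> \<longleftrightarrow> partition_on (carrier S) \<E> \<and>
     (\<forall>X Y. X \<subseteq> carrier S \<and> finite X \<and> Y \<subseteq> carrier S \<and> finite Y \<and>
        (\<forall>E\<in>\<E>. card (X \<inter> E) = card (Y \<inter> E)) \<longrightarrow>
        isomorphic L (induced S X) (induced S Y))"

definition admits_finite_monomorphic_decomposition :: "'r language \<Rightarrow> ('a, 'r) rel_struct \<Rightarrow> bool" where
  "admits_finite_monomorphic_decomposition L S \<longleftrightarrow>
     (\<exists>\<E>. finite \<E> \<and> monomorphic_decomposition L S \<E>)"

definition minimal_monomorphic_decomposition :: "'r language \<Rightarrow> ('a, 'r) rel_struct \<Rightarrow> 'a set set \<Rightarrow> bool" where
  "minimal_monomorphic_decomposition L S \<B> \<longleftrightarrow> monomorphic_decomposition L S \<B> \<and>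
     (\<forall>\<E>. monomorphic_decomposition L S \<E> \<longrightarrow> refines (carrier S) \<E> \<B>)"

end

theory Submission
  imports Defs
begin

text \<open>A self-embedding \<open>w\<close> of \<open>S\<close> pulls the minimal decomposition \<open>\<B>\<close> back to a monomorphic
  decomposition with at most \<open>card \<B>\<close> blocks. By minimality the pullback refines \<open>\<B>\<close>, hence equals
  \<open>\<B>\<close>, so \<open>w\<close> permutes the blocks and some power of \<open>w\<close> maps a given block \<open>B\<close> into itself. Since
  \<open>w\<^sup>n \<circ> Emb(A, S) \<subseteq> w \<circ> Emb(A, S)\<close> for \<open>n > 0\<close>, that power inherits the bound on the number of
  colours from \<open>w\<close>, and so does its restriction to \<open>B\<close>.\<close>

section \<open>Embeddings and isomorphisms of induced substructures\<close>

lemma carrier_induced [simp]: "carrier (induced S X) = X"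
  by (simp add: induced_def)

lemma induced_induced: "X \<subseteq> B \<Longrightarrow> induced (induced S B) X = induced S X"
  unfolding induced_def by auto

lemma EmbD:
  assumes "f \<in> Emb L A B"
  shows "f \<in> extensional (carrier A)" "f \<in> carrier A \<rightarrow> carrier B" "inj_on f (carrier A)"
    and "\<And>R xs. R \<in> symbols L \<Longrightarrow> length xs = arity L R \<Longrightarrow> set xs \<subseteq> carrier A \<Longrightarrow>
      xs \<in> interp A R \<longleftrightarrow> map f xs \<in> interp B R"
  using assms unfolding Emb_def PiE_def by auto

lemma EmbI:
  assumes "f \<in> extensional (carrier A)" "f \<in> carrier A \<rightarrow> carrier B" "inj_on f (carrier A)"
    and "\<And>R xs. R \<in> symbols L \<Longrightarrow> length xs = arity L R \<Longrightarrow> set xs \<subseteq> carrier A \<Longrightarrow>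
      xs \<in> interp A R \<longleftrightarrow> map f xs \<in> interp B R"
  shows "f \<in> Emb L A B"
  using assms unfolding Emb_def PiE_def by auto

lemma restrict_map_eq: "set xs \<subseteq> A \<Longrightarrow> map (restrict f A) xs = map f xs"
  by (auto simp: restrict_def)

lemma compose_map_eq: "set xs \<subseteq> A \<Longrightarrow> map (compose A g f) xs = map g (map f xs)"
  by (auto simp: compose_def)

lemma compose_Emb:
  assumes f: "f \<in> Emb L A B" and g: "g \<in> Emb L B C"
  shows "compose (carrier A) g f \<in> Emb L A C"
proof (rule EmbI)
  show "compose (carrier A) g f \<in> carrier A \<rightarrow> carrier C"
    using EmbD(2)[OF f] EmbD(2)[OF g] by (auto simp: compose_def)
  show "inj_on (compose (carrier A) g f) (carrier A)"
  proof (rule inj_onI)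
    fix x y assume "x \<in> carrier A" "y \<in> carrier A"
      and "compose (carrier A) g f x = compose (carrier A) g f y"
    then show "x = y"
      using EmbD(2,3)[OF f] EmbD(3)[OF g] by (auto simp: compose_eq inj_on_def Pi_iff)
  qed
  fix R xs assume R: "R \<in> symbols L" "length xs = arity L R" "set xs \<subseteq> carrier A"
  moreover have "set (map f xs) \<subseteq> carrier B"
    using R EmbD(2)[OF f] by auto
  ultimately show "xs \<in> interp A R \<longleftrightarrow> map (compose (carrier A) g f) xs \<in> interp C R"
    using EmbD(4)[OF f R] EmbD(4)[OF g, of R "map f xs"] by (simp only: compose_map_eq length_map)
qed simp

lemma restrict_Emb:
  assumes f: "f \<in> Emb L S T" and X: "X \<subseteq> carrier S"
  shows "restrict f X \<in> Emb L (induced S X) T"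
proof (rule EmbI)
  show "restrict f X \<in> carrier (induced S X) \<rightarrow> carrier T"
    using EmbD(2)[OF f] X by auto
  show "inj_on (restrict f X) (carrier (induced S X))"
    using inj_on_subset[OF EmbD(3)[OF f] X] by (auto simp: inj_on_def)
  fix R xs assume R: "R \<in> symbols L" "length xs = arity L R" "set xs \<subseteq> carrier (induced S X)"
  then show "xs \<in> interp (induced S X) R \<longleftrightarrow> map (restrict f X) xs \<in> interp T R"
    using EmbD(4)[OF f R(1,2)] X by (simp only: restrict_map_eq carrier_induced) (auto simp: induced_def)
qed simp

text \<open>The relations of \<open>induced S B\<close> are those of \<open>S\<close> cut down to
  tuples over \<open>B\<close>, so only the range of \<open>f\<close> matters. This moves embeddings
  between \<open>S\<close> and one of its blocks.\<close>

lemma Emb_induced_iff: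
  assumes "B \<subseteq> carrier S"
  shows "f \<in> Emb L A (induced S B) \<longleftrightarrow> f \<in> Emb L A S \<and> f ` carrier A \<subseteq> B"
proof
  assume f: "f \<in> Emb L A (induced S B)"
  have fB: "f \<in> carrier A \<rightarrow> B"
    using EmbD(2)[OF f] by simp
  have "f \<in> Emb L A S"
  proof (rule EmbI)
    fix R xs assume R: "R \<in> symbols L" "length xs = arity L R" "set xs \<subseteq> carrier A"
    show "xs \<in> interp A R \<longleftrightarrow> map f xs \<in> interp S R"
      using EmbD(4)[OF f R] fB R(3) by (auto simp: induced_def)
  qed (use assms EmbD[OF f] fB in auto)
  with fB show "f \<in> Emb L A S \<and> f ` carrier A \<subseteq> B" by auto
next
  assume f: "f \<in> Emb L A S \<and> f ` carrier A \<subseteq> B"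
  show "f \<in> Emb L A (induced S B)"
  proof (rule EmbI)
    fix R xs assume R: "R \<in> symbols L" "length xs = arity L R" "set xs \<subseteq> carrier A"
    show "xs \<in> interp A R \<longleftrightarrow> map f xs \<in> interp (induced S B) R"
      using EmbD(4)[of f L A S, OF _ R] f R(3) by (auto simp: induced_def)
  qed (use f EmbD[of f L A S] in auto)
qed

lemma isomorphic_sym:
  assumes "isomorphic L A B"
  shows "isomorphic L B A"
proof -
  from assms obtain f where f: "f \<in> Emb L A B" and surj: "f ` carrier A = carrier B"
    unfolding isomorphic_def by blast
  let ?g = "restrict (inv_into (carrier A) f) (carrier B)"
  have bij: "bij_betw f (carrier A) (carrier B)"
    using EmbD(3)[OF f] surj by (simp add: bij_betw_def)
  have bij': "bij_betw (inv_into (carrier A) f) (carrier B) (carrier A)"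
    using bij by (rule bij_betw_inv_into)
  have "?g \<in> Emb L B A"
  proof (rule EmbI)
    show "?g \<in> carrier B \<rightarrow> carrier A"
      using bij' by (auto simp: bij_betw_def)
    show "inj_on ?g (carrier B)"
      using bij' by (simp add: bij_betw_def inj_on_restrict_eq)
    fix R ys assume R: "R \<in> symbols L" "length ys = arity L R" "set ys \<subseteq> carrier B"
    let ?xs = "map (inv_into (carrier A) f) ys"
    have "map f ?xs = ys"
      using R(3) surj by (auto intro!: map_idI simp: f_inv_into_f subset_iff)
    moreover have "set ?xs \<subseteq> carrier A"
      using R(3) bij' by (auto simp: bij_betw_def)
    ultimately show "ys \<in> interp B R \<longleftrightarrow> map ?g ys \<in> interp A R"
      using EmbD(4)[OF f R(1), of ?xs] R by (simp only: restrict_map_eq length_map)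
  qed simp
  moreover have "?g ` carrier B = carrier A"
    using bij' by (simp add: bij_betw_def)
  ultimately show ?thesis
    unfolding isomorphic_def by blast
qed

lemma isomorphic_trans:
  assumes "isomorphic L A B" "isomorphic L B C"
  shows "isomorphic L A C"
proof -
  from assms obtain f g where f: "f \<in> Emb L A B" "f ` carrier A = carrier B"
    and g: "g \<in> Emb L B C" "g ` carrier B = carrier C"
    unfolding isomorphic_def by blast
  have "compose (carrier A) g f ` carrier A = g ` f ` carrier A"
    by (auto simp: compose_def)
  then have "compose (carrier A) g f ` carrier A = carrier C"
    using f(2) g(2) by simp
  with compose_Emb[OF f(1) g(1)] show ?thesis
    unfolding isomorphic_def by blast
qed

lemma isomorphic_induced_image:
  assumes w: "w \<in> Emb L S T" and X: "X \<subseteq> carrier S"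
  shows "isomorphic L (induced S X) (induced T (w ` X))"
proof -
  have "w ` X \<subseteq> carrier T"
    using EmbD(2)[OF w] X by auto
  then have "restrict w X \<in> Emb L (induced S X) (induced T (w ` X))"
    using restrict_Emb[OF w X] by (simp add: Emb_induced_iff)
  moreover have "restrict w X ` X = w ` X" by simp
  ultimately show ?thesis
    unfolding isomorphic_def by (metis carrier_induced)
qed

section \<open>Pulling monomorphic decompositions back along embeddings\<close>

definition pullback :: "('a \<Rightarrow> 'b) \<Rightarrow> 'a set \<Rightarrow> 'b set \<Rightarrow> 'a set" where
  "pullback w A C = {x \<in> A. w x \<in> C}"

text \<open>By injectivity of \<open>w\<close>, the image of a set meets a block in as many points
  as the set meets the pullback of that block. Equal counts for \<open>X\<close> and
  \<open>Y\<close> thus give equal counts for their images; these induce isomorphic substructures of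
  \<open>T\<close>, and \<open>w\<close> transports the isomorphism back to \<open>S\<close>. Empty
  pullbacks cannot be blocks of a partition and are removed.\<close>

lemma monomorphic_decomposition_pullback:
  assumes w: "w \<in> Emb L S T" and D: "monomorphic_decomposition L T \<E>"
  shows "monomorphic_decomposition L S (pullback w (carrier S) ` \<E> - {{}})"
proof -
  have part: "partition_on (carrier T) \<E>"
    using D by (simp add: monomorphic_decomposition_def)
  have wS: "w \<in> carrier S \<rightarrow> carrier T"
    using EmbD(2)[OF w] .
  have "partition_on (carrier S) (pullback w (carrier S) ` \<E> - {{}})"
  proof (rule partition_onI)
    show "\<Union> (pullback w (carrier S) ` \<E> - {{}}) = carrier S"
      using wS unfolding partition_onD1[OF part] pullback_def by blast
    fix p q assume "p \<in> pullback w (carrier S) ` \<E> - {{}}" "q \<in> pullback w (carrier S) ` \<E> - {{}}" "p \<noteq> q"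
    then show "disjnt p q"
      using partition_onD2[OF part] by (auto simp: pullback_def disjoint_def disjnt_def)
  qed auto
  moreover have "isomorphic L (induced S X) (induced S Y)"
    if XY: "X \<subseteq> carrier S" "finite X" "Y \<subseteq> carrier S" "finite Y"
      and eq: "\<forall>E\<in>pullback w (carrier S) ` \<E> - {{}}. card (X \<inter> E) = card (Y \<inter> E)" for X Y
  proof -
    have card_pullback: "card (w ` Z \<inter> E) = card (Z \<inter> pullback w (carrier S) E)"
      if Z: "Z \<subseteq> carrier S" for Z E
    proof -
      have "w ` Z \<inter> E = w ` (Z \<inter> pullback w (carrier S) E)"
        using Z by (auto simp: pullback_def)
      moreover have "inj_on w (Z \<inter> pullback w (carrier S) E)"
        using EmbD(3)[OF w] by (rule inj_on_subset) (auto simp: pullback_def)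
      ultimately show ?thesis by (simp add: card_image)
    qed
    have "card (w ` X \<inter> E) = card (w ` Y \<inter> E)" if "E \<in> \<E>" for E
    \<comment> \<open>\<open>eq\<close> says nothing about blocks with empty pullback, but for those
      both counts are 0.\<close>
    proof (cases "pullback w (carrier S) E = {}")
      case False
      with that eq show ?thesis by (simp add: card_pullback XY)
    qed (simp add: card_pullback XY)
    moreover have "w ` X \<subseteq> carrier T" "w ` Y \<subseteq> carrier T"
      using wS XY by auto
    ultimately have "isomorphic L (induced T (w ` X)) (induced T (w ` Y))"
      using D XY unfolding monomorphic_decomposition_def by blast
    with isomorphic_induced_image[OF w XY(1)] isomorphic_induced_image[OF w XY(3)] show ?thesis
      by (blast intro: isomorphic_trans isomorphic_sym)
  qed
  ultimately show ?thesis
    unfolding monomorphic_decomposition_def by blast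
qed

section \<open>Refinements of finite partitions, and the action of a self-embedding on the
  blocks\<close>

lemma refines_obtains_surj:
  assumes "refines A Q P"
  obtains s where "\<And>E. E \<in> Q \<Longrightarrow> E \<subseteq> s E" "s ` Q = P"
proof -
  have P: "partition_on A P" and Q: "partition_on A Q" and "\<forall>E\<in>Q. \<exists>B\<in>P. E \<subseteq> B"
    using assms by (auto simp: refines_def)
  then obtain s where s: "\<And>E. E \<in> Q \<Longrightarrow> s E \<in> P \<and> E \<subseteq> s E" by metis
  have "B \<in> s ` Q" if "B \<in> P" for B
  proof -
    from that partition_onD3[OF P] have "B \<noteq> {}" by blast
    then obtain x where "x \<in> B" by blast
    with that have "x \<in> \<Union>Q"
      using partition_onD1[OF P] partition_onD1[OF Q] by blast
    then obtain E where "E \<in> Q" "x \<in> E" by blast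
    with \<open>x \<in> B\<close> have "s E = B"
      using s[of E] that partition_onD2[OF P] by (auto simp: disjoint_def)
    with \<open>E \<in> Q\<close> show ?thesis by blast
  qed
  with s that show thesis by blast
qed

lemma refines_finite:
  assumes "refines A Q P" "finite Q"
  shows "finite P"
  using assms by (metis refines_obtains_surj finite_imageI)

text \<open>The cardinality bound makes the surjection from fine blocks to the coarse blocks
  containing them injective. A coarse block then contains only one fine block, and so equals
  it.\<close>

lemma refines_card_le_eq:
  assumes "refines A Q P" "finite Q" "card Q \<le> card P"
  shows "Q = P"
proof -
  have P: "partition_on A P" and Q: "partition_on A Q"
    using assms by (auto simp: refines_def)
  obtain s where s: "\<And>E. E \<in> Q \<Longrightarrow> E \<subseteq> s E" "s ` Q = P"
    using refines_obtains_surj[OF assms(1)] by blast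
  have inj: "inj_on s Q"
    using assms s(2) card_image_le[OF assms(2), of s] by (auto intro: eq_card_imp_inj_on)
  have "s E = E" if "E \<in> Q" for E
  proof
    show "s E \<subseteq> E"
    proof
      fix x assume x: "x \<in> s E"
      have sE: "s E \<in> P"
        using that s(2) by blast
      with x have "x \<in> \<Union>Q"
        using partition_onD1[OF P] partition_onD1[OF Q] by blast
      then obtain E' where E': "E' \<in> Q" "x \<in> E'" by blast
      then have "s E' \<in> P" "x \<in> s E'"
        using s by blast+
      with x sE have "s E' = s E"
        using partition_onD2[OF P] by (auto simp: disjoint_def)
      with inj E' that show "x \<in> E" by (auto simp: inj_on_def)
    qed
  qed (use that s in auto)
  with s(2) show ?thesis by auto
qed

lemma pullback_bij_betw:
  assumes w: "w \<in> Emb L S S" and min: "minimal_monomorphic_decomposition L S \<B>"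
    and fin: "finite \<B>"
  shows "bij_betw (pullback w (carrier S)) \<B> \<B>"
proof -
  let ?\<rho> = "pullback w (carrier S)"
  let ?\<E> = "?\<rho> ` \<B> - {{}}"
  have "monomorphic_decomposition L S \<B>"
    using min by (simp add: minimal_monomorphic_decomposition_def)
  then have "refines (carrier S) ?\<E> \<B>"
    using monomorphic_decomposition_pullback[OF w] min
    by (simp add: minimal_monomorphic_decomposition_def)
  moreover have "card ?\<E> \<le> card \<B>"
    using fin by (meson card_Diff1_le card_image_le le_trans)
  ultimately have "?\<E> = \<B>"
    using fin by (intro refines_card_le_eq) auto
  \<comment> \<open>Counting turns this inclusion into an equality, which rules out empty pullbacks
    and forces injectivity of \<open>?\<rho>\<close> on \<open>\<B>\<close>.\<close>
  then have sub: "\<B> \<subseteq> ?\<rho> ` \<B>" by auto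
  have "card (?\<rho> ` \<B>) \<le> card \<B>"
    by (rule card_image_le[OF fin])
  with sub fin have "?\<rho> ` \<B> = \<B>"
    by (metis card_seteq finite_imageI)
  with fin show ?thesis
    by (simp add: bij_betw_def eq_card_imp_inj_on)
qed

section \<open>Iterates of permutations and of self-embeddings\<close>

lemma bij_betw_funpow_fixpoint:
  assumes bij: "bij_betw f A A" and fin: "finite A" and x: "x \<in> A"
  obtains n where "(f ^^ Suc n) x = x"
proof -
  have iter: "bij_betw (f ^^ n) A A" for n
    using bij by (rule bij_betw_funpow)
  \<comment> \<open>Pigeonhole: the orbit of \<open>x\<close> stays in a finite set, so it repeats.
    Cancelling the injective \<open>f ^^ i\<close> turns the repetition into a return to
    \<open>x\<close> after a positive number of steps.\<close>
  have "range (\<lambda>n. (f ^^ n) x) \<subseteq> A"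
    using iter x by (auto simp: bij_betw_def)
  with fin have "\<not> inj (\<lambda>n. (f ^^ n) x)"
    by (meson finite_subset range_inj_infinite)
  then obtain i j where "i < j" "(f ^^ i) x = (f ^^ j) x"
    by (metis linorder_less_linear injI)
  then obtain d where "(f ^^ i) ((f ^^ Suc d) x) = (f ^^ i) x"
    by (metis less_imp_Suc_add add_Suc_right comp_apply funpow_add)
  then have "(f ^^ Suc d) x = x"
    using iter[of i] iter[of "Suc d"] x by (meson bij_betw_apply bij_betw_def inj_onD)
  with that show thesis .
qed

text \<open>Powers of an extensional map need not be extensional: the zeroth is the identity
  everywhere. Hence the restriction.\<close>

lemma restrict_funpow_Emb:
  assumes w: "w \<in> Emb L S S"
  shows "restrict (w ^^ n) (carrier S) \<in> Emb L S S"
proof (induction n)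
  case 0
  show ?case
    by (rule EmbI) (auto simp: restrict_map_eq inj_on_restrict_eq simp del: restrict_apply)
next
  case (Suc n)
  have "restrict (w ^^ Suc n) (carrier S) = compose (carrier S) w (restrict (w ^^ n) (carrier S))"
    by (auto simp: compose_def)
  with compose_Emb[OF Suc w] show ?case by (simp only:)
qed

text \<open>Converts periodicity of a block under pullback into a statement about a power of
  \<open>w\<close>. Since \<open>w\<close> maps the carrier into itself, the intermediate membership
  conditions hold automatically.\<close>

lemma pullback_funpow:
  assumes w: "w \<in> Emb L S S" and C: "C \<subseteq> carrier S"
  shows "(pullback w (carrier S) ^^ n) C = pullback (w ^^ n) (carrier S) C"
proof (induction n)
  case 0
  show ?case using C by (auto simp: pullback_def)
next
  case (Suc n)
  \<comment> \<open>Iterated pullback applies the additional \<open>w\<close> first, whereas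
    \<open>funpow\<close> unfolds with it applied last.\<close>
  have "(w ^^ n) (w x) = w ((w ^^ n) x)" for x
    by (metis funpow_swap1)
  with Suc show ?case
    using EmbD(2)[OF w] by (auto simp: pullback_def)
qed

section \<open>Transfer of Ramsey bounds to a block\<close>

lemma big_ramsey_degree_finite_iff: "big_ramsey_degree L A C < \<infinity> \<longleftrightarrow> (\<exists>t. ramsey_bound L A C t)"
  by (simp add: big_ramsey_degree_def)

lemma ramsey_bound_induced:
  assumes bound: "ramsey_bound L A S t"
    and B: "B \<subseteq> carrier S"
    and ret: "\<And>w. w \<in> Emb L S S \<Longrightarrow> \<exists>n. (w ^^ Suc n) ` B \<subseteq> B"
  shows "ramsey_bound L A (induced S B) t"
  unfolding ramsey_bound_def
proof (intro conjI allI impI ballI)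
  show "t > 0" using bound by (simp add: ramsey_bound_def)
  fix k :: nat and \<chi> assume k: "k > 0" and \<chi>: "\<chi> \<in> Emb L A (induced S B) \<rightarrow> {..<k}"
  \<comment> \<open>The colouring is extended to all embeddings into \<open>S\<close>; the default 0
    is a legal colour because \<open>k > 0\<close>.\<close>
  define \<chi>' where "\<chi>' f = (if f \<in> Emb L A (induced S B) then \<chi> f else 0)" for f
  have \<chi>': "\<chi>' \<in> Emb L A S \<rightarrow> {..<k}"
    using k \<chi> by (auto simp: \<chi>'_def)
  with bound k obtain w where w: "w \<in> Emb L S S"
    and card: "card (\<chi>' ` (compose (carrier A) w ` Emb L A S)) \<le> t"
    unfolding ramsey_bound_def by blast
  obtain n where n: "(w ^^ Suc n) ` B \<subseteq> B"
    using ret[OF w] by blast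
  let ?v = "restrict (w ^^ Suc n) B"
  have "restrict (restrict (w ^^ Suc n) (carrier S)) B \<in> Emb L (induced S B) S"
    using restrict_funpow_Emb[OF w] B by (rule restrict_Emb)
  moreover have "restrict (restrict (w ^^ Suc n) (carrier S)) B = ?v"
    using B by (simp add: Int_absorb1 del: funpow.simps)
  moreover have "?v ` B \<subseteq> B"
    using n by auto
  ultimately have v: "?v \<in> Emb L (induced S B) (induced S B)"
    using B by (simp add: Emb_induced_iff)
  have "\<chi> (compose (carrier A) ?v f) \<in> \<chi>' ` (compose (carrier A) w ` Emb L A S)"
    if f: "f \<in> Emb L A (induced S B)" for f
  proof -
    let ?g = "compose (carrier A) (restrict (w ^^ n) (carrier S)) f"
    have f': "f \<in> Emb L A S" "f ` carrier A \<subseteq> B"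
      using f B by (simp_all add: Emb_induced_iff)
    have "?g \<in> Emb L A S"
      using f'(1) restrict_funpow_Emb[OF w] by (rule compose_Emb)
    \<comment> \<open>One outer \<open>w\<close> is split off the power, which is possible because
      the exponent is \<open>Suc n\<close>; the remaining \<open>n\<close> factors go into
      \<open>?g\<close>.\<close>
    moreover have "compose (carrier A) ?v f = compose (carrier A) w ?g"
      using f'(2) B by (fastforce simp: compose_def)
    moreover have "\<chi> (compose (carrier A) ?v f) = \<chi>' (compose (carrier A) ?v f)"
      using compose_Emb[OF f v] by (simp add: \<chi>'_def)
    ultimately show ?thesis by simp
  qed
  then have "\<chi> ` (compose (carrier A) ?v ` Emb L A (induced S B)) \<subseteq>
      \<chi>' ` (compose (carrier A) w ` Emb L A S)"
    by blast
  \<comment> \<open>Monotonicity of \<open>card\<close> needs a finite larger set, as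
    \<open>card\<close> of an infinite set is 0.\<close>
  moreover have "finite (\<chi>' ` (compose (carrier A) w ` Emb L A S))"
  proof (rule finite_subset)
    show "\<chi>' ` (compose (carrier A) w ` Emb L A S) \<subseteq> {..<k}"
      using \<chi>' compose_Emb[OF _ w] by blast
  qed simp
  ultimately have "card (\<chi> ` (compose (carrier A) ?v ` Emb L A (induced S B))) \<le> t"
    using card by (meson card_mono le_trans)
  with v show "\<exists>v\<in>Emb L (induced S B) (induced S B).
      card (\<chi> ` (compose (carrier A) v ` Emb L A (induced S B))) \<le> t"
    by blast
qed

theorem theorem4p4:
  fixes L :: "'r language" and S :: "('a, 'r) rel_struct" and \<B> :: "'a set set"
  assumes "relational_language L"
    and "relational_structure L S"
    and "admits_finite_monomorphic_decomposition L S"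
    and "minimal_monomorphic_decomposition L S \<B>"
    and "finite_big_ramsey_degrees L S"
  shows "\<forall>B\<in>\<B>. finite_big_ramsey_degrees L (induced S B)"
proof
  fix B assume B: "B \<in> \<B>"
  have "partition_on (carrier S) \<B>"
    using assms(4) by (simp add: minimal_monomorphic_decomposition_def monomorphic_decomposition_def)
  then have BS: "B \<subseteq> carrier S"
    using B partition_onD1 by blast
  \<comment> \<open>The given finite decomposition refines \<open>\<B>\<close>, so it has at least
    as many blocks.\<close>
  have fin: "finite \<B>"
    using assms(3,4) refines_finite
    unfolding admits_finite_monomorphic_decomposition_def minimal_monomorphic_decomposition_def by blast
  have ret: "\<exists>n. (w ^^ Suc n) ` B \<subseteq> B" if w: "w \<in> Emb L S S" for w
  proof -
    obtain n where "(pullback w (carrier S) ^^ Suc n) B = B"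
      using bij_betw_funpow_fixpoint[OF pullback_bij_betw[OF w assms(4) fin] fin B] .
    then have "pullback (w ^^ Suc n) (carrier S) B = B"
      by (simp only: pullback_funpow[OF w BS])
    then have "(w ^^ Suc n) ` B \<subseteq> B"
      unfolding pullback_def by blast
    then show ?thesis ..
  qed
  show "finite_big_ramsey_degrees L (induced S B)"
    unfolding finite_big_ramsey_degrees_def
  proof (intro allI impI)
    fix X assume "X \<subseteq> carrier (induced S B) \<and> finite X \<and> X \<noteq> {}"
    then have X: "X \<subseteq> B" "finite X" "X \<noteq> {}" by auto
    \<comment> \<open>\<open>X\<close> is also a finite subset of \<open>S\<close> and induces the
      same structure there as inside the block.\<close>
    then have "big_ramsey_degree L (induced S X) S < \<infinity>"
      using assms(5) BS unfolding finite_big_ramsey_degrees_def by blast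
    then obtain t where "ramsey_bound L (induced S X) S t"
      unfolding big_ramsey_degree_finite_iff ..
    then have "ramsey_bound L (induced S X) (induced S B) t"
      using BS ret by (rule ramsey_bound_induced)
    then show "big_ramsey_degree L (induced (induced S B) X) (induced S B) < \<infinity>"
      unfolding big_ramsey_degree_finite_iff induced_induced[OF X(1)] ..
  qed
qed

end
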